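(* Let $Q\in\mathbb{R}^{n\times n}$ be symmetric positive definite and $Z\subseteq\{0,1\}^n$. Let $$M=\lambda_{\max}(Q^{-1})\,\max_{i\in[n]}\|Q_{[n],\{i\}}\|_2 .$$ Then the extreme points of $P$ are described as $$\begin{aligned}\left\{(\hat{\mathbf{e}}_S,\hat Q_S^{-1}):\hat{\mathbf{e}}_S\in Z\right\}=\Big\{(z,W)\in Z\times\mathbb{R}^{n\times n}:\ &\sum_{k=1}^nQ_{ik}W_{ki}=z_i\ \ \forall i\in[n],\\ &-M(1-z_i)\le\sum_{k=1}^nQ_{ik}W_{kj}\le M(1-z_i)\ \ \forall i\ne j,\\ &|W_{ij}|\le\lambda_{\max}(Q^{-1})\min\{z_i,z_j\}\ \ \forall i,j\in[n]\Big\}.\end{aligned}$$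
   Context: $[n]=\{1,\dots,n\}$. For $S\subseteq[n]$, $\hat{\mathbf{e}}_S\in\{0,1\}^n$ is the indicator vector of $S$, $Q_S$ is the principal submatrix of $Q$ indexed by $S$, and $\hat Q_S^{-1}\in\mathbb{R}^{n\times n}$ is the matrix whose submatrix indexed by $S$ equals $Q_S^{-1}$ and whose other entries are all zero. The polytope $P\subseteq\mathbb{R}^{n+n^2}$ is $$P=\operatorname{conv}\{(\hat{\mathbf{e}}_S,\hat Q_S^{-1}): \hat{\mathbf{e}}_S\in Z\}.$$ $Q_{[n],\{i\}}$ is the $i$-th column of $Q$, $\|\cdot\|_2$ is the Euclidean norm of a vector, and $\lambda_{\max}(\cdot)$ is the largest eigenvalue. *)

theory Defs
  imports "HOL-Analysis.Analysis"
begin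

(* The index set {1, ..., n} is the finite type 'n. *)

definition symmetric_matrix :: "real^'n^'n \<Rightarrow> bool" where
  "symmetric_matrix A \<longleftrightarrow> transpose A = A"

definition positive_definite :: "real^'n^'n \<Rightarrow> bool" where
  "positive_definite A \<longleftrightarrow> (\<forall>x. x \<noteq> 0 \<longrightarrow> x \<bullet> (A *v x) > 0)"

definition is_eigenvalue :: "real^'n^'n \<Rightarrow> real \<Rightarrow> bool" where
  "is_eigenvalue A l \<longleftrightarrow> (\<exists>v. v \<noteq> 0 \<and> A *v v = l *\<^sub>R v)"

(* Only real eigenvalues are considered; this is meant for symmetric matrices. *)
definition lambda_max :: "real^'n^'n \<Rightarrow> real" where
  "lambda_max A = Max {l. is_eigenvalue A l}"

definition indicator_vec :: "'n set \<Rightarrow> real^'n" where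
  "indicator_vec S = (\<chi> i. of_bool (i \<in> S))"

(* A matrix with rows and columns indexed by S is a function of two indices of which only
   the values on S \<times> S matter.  Thus the principal submatrix of Q indexed by S is
   \<lambda>i j. Q$i$j, read on S \<times> S. *)
definition is_inverse_on :: "'n set \<Rightarrow> ('n \<Rightarrow> 'n \<Rightarrow> real) \<Rightarrow> ('n \<Rightarrow> 'n \<Rightarrow> real) \<Rightarrow> bool" where
  "is_inverse_on S A B \<longleftrightarrow>
     (\<forall>i\<in>S. \<forall>j\<in>S. (\<Sum>k\<in>S. A i k * B k j) = of_bool (i = j)) \<and>
     (\<forall>i\<in>S. \<forall>j\<in>S. (\<Sum>k\<in>S. B i k * A k j) = of_bool (i = j))"

(* As for matrix_inv.  The values on S \<times> S are unique whenever an inverse exists;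
   the values elsewhere are unspecified. *)
definition inverse_on :: "'n set \<Rightarrow> ('n \<Rightarrow> 'n \<Rightarrow> real) \<Rightarrow> 'n \<Rightarrow> 'n \<Rightarrow> real" where
  "inverse_on S A = (SOME B. is_inverse_on S A B)"

definition padded_inverse :: "real^'n^'n \<Rightarrow> 'n set \<Rightarrow> real^'n^'n" where
  "padded_inverse Q S =
     (\<chi> i j. if i \<in> S \<and> j \<in> S then inverse_on S (\<lambda>i j. Q$i$j) i j else 0)"

definition generators :: "real^'n^'n \<Rightarrow> (real^'n) set \<Rightarrow> ((real^'n) \<times> (real^'n^'n)) set" where
  "generators Q Z = {(indicator_vec S, padded_inverse Q S) | S. indicator_vec S \<in> Z}"

definition polytope_P :: "real^'n^'n \<Rightarrow> (real^'n) set \<Rightarrow> ((real^'n) \<times> (real^'n^'n)) set" where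
  "polytope_P Q Z = convex hull (generators Q Z)"

end

theory Submission
  imports Defs
begin

text \<open>
  Both equalities rest on one spectral estimate. Let \<open>L\<close> be the largest eigenvalue of \<open>Q\<^sup>-\<^sup>1\<close>. Minimising
  the Rayleigh quotient of \<open>Q\<close> yields an eigenvector, whence \<open>x \<bullet> x \<le> L * (x \<bullet> Q x)\<close> for all \<open>x\<close>
  (\<open>norm_le_lambda_max_form\<close>). If \<open>j \<in> S\<close> and \<open>w\<close> is the \<open>j\<close>-th column of the padded inverse, then
  \<open>w\<close> vanishes off \<open>S\<close> and \<open>(Q w)\<^sub>i = \<delta>\<^sub>i\<^sub>j\<close> for \<open>i \<in> S\<close>; so \<open>w \<bullet> Q w = w\<^sub>j\<close> and the estimate
  gives \<open>\<parallel>w\<parallel>\<^sup>2 \<le> L * w\<^sub>j \<le> L * \<parallel>w\<parallel>\<close>, that is \<open>\<parallel>w\<parallel> \<le> L\<close> (\<open>norm_column_padded_inverse_le\<close>). This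
  bounds the entries of \<open>W\<close> by \<open>L\<close>, and by Cauchy-Schwarz those of \<open>Q W\<close> by \<open>M\<close>, so every
  generator satisfies the inequalities.

  Conversely, if \<open>z\<close> is the indicator vector of \<open>S\<close>, the bound by \<open>min z\<^sub>i z\<^sub>j\<close> forces \<open>W\<close> to vanish
  outside \<open>S \<times> S\<close>, and the remaining constraints with \<open>i, j \<in> S\<close> say that the submatrix of \<open>W\<close>
  is a right inverse of that of \<open>Q\<close>; hence \<open>W\<close> is the padded inverse
  (\<open>padded_inverse_unique\<close>).

  Each generator is an extreme point because its first component is a vertex of the unit cube,
  which determines it: the linear functional \<open>z \<mapsto> (2 e\<^sub>S - 1) \<bullet> z\<close> is larger at \<open>e\<^sub>S\<close> than at any
  other vertex, where \<open>e\<^sub>S\<close> is the indicator vector of \<open>S\<close> and \<open>1\<close> the all-ones vector.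
\<close>

section \<open>The quadratic form of a symmetric positive definite matrix\<close>

lemma symmetric_matrix_inner:
  fixes A :: "real^'n^'n"
  assumes "symmetric_matrix A"
  shows "x \<bullet> (A *v y) = (A *v x) \<bullet> y"
  using assms unfolding symmetric_matrix_def
  by (metis dot_lmul_matrix transpose_matrix_vector)

lemma finite_eigenvalues:
  fixes A :: "real^'n^'n"
  assumes "symmetric_matrix A"
  shows "finite {l. is_eigenvalue A l}"
proof -
  let ?E = "{l. is_eigenvalue A l}"
  define v where "v l = (SOME v. v \<noteq> 0 \<and> A *v v = l *\<^sub>R v)" for l
  have v: "v l \<noteq> 0 \<and> A *v v l = l *\<^sub>R v l" if "l \<in> ?E" for l
    unfolding v_def by (rule someI_ex) (use that in \<open>simp add: is_eigenvalue_def\<close>)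
  \<comment> \<open>Eigenvectors for distinct eigenvalues are orthogonal, hence linearly independent.\<close>
  have orth: "v l \<bullet> v m = 0" if "l \<in> ?E" "m \<in> ?E" "l \<noteq> m" for l m
  proof -
    have "v l \<bullet> (A *v v m) = (A *v v l) \<bullet> v m"
      by (rule symmetric_matrix_inner[OF assms])
    then have "m * (v l \<bullet> v m) = l * (v l \<bullet> v m)"
      using v[OF that(1)] v[OF that(2)] by simp
    then show ?thesis using that(3) by simp
  qed
  have "inj_on v ?E"
    by (rule inj_onI) (metis orth v inner_eq_zero_iff)
  moreover have "independent (v ` ?E)"
  proof (rule pairwise_orthogonal_independent)
    show "pairwise orthogonal (v ` ?E)"
      unfolding pairwise_def orthogonal_def using orth by fast
    show "0 \<notin> v ` ?E" using v by auto
  qed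
  then have "finite (v ` ?E)" by (rule independent_imp_finite)
  ultimately show ?thesis by (rule finite_imageD[rotated])
qed

text \<open>If the form of \<open>A - \<mu> I\<close> is nonnegative, then a vector at which it vanishes lies in the kernel:
  a first-order variation in the direction \<open>w = A u - \<mu> u\<close> would otherwise make it negative.\<close>
lemma eigenvector_if_form_minimal:
  fixes A :: "real^'n^'n"
  assumes sym: "symmetric_matrix A"
    and ge: "\<And>x. \<mu> * (x \<bullet> x) \<le> x \<bullet> (A *v x)"
    and eq: "u \<bullet> (A *v u) = \<mu> * (u \<bullet> u)"
  shows "A *v u = \<mu> *\<^sub>R u"
proof (rule ccontr)
  define w where "w = A *v u - \<mu> *\<^sub>R u"
  define c where "c = w \<bullet> (A *v w) - \<mu> * (w \<bullet> w)"
  assume "A *v u \<noteq> \<mu> *\<^sub>R u"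
  then have w: "w \<bullet> w > 0" by (simp add: w_def)
  have c: "c \<ge> 0" using ge[of w] by (simp add: c_def)
  \<comment> \<open>At \<open>u - s w\<close> the form is \<open>- 2 s (w \<bullet> w) + s\<^sup>2 c\<close>; this \<open>s\<close> is small enough for the linear
    term to dominate.\<close>
  define s where "s = w \<bullet> w / (c + 1)"
  have s: "s > 0" using w c by (simp add: s_def)
  have cross: "u \<bullet> (A *v w) - \<mu> * (u \<bullet> w) = w \<bullet> w"
    "w \<bullet> (A *v u) - \<mu> * (w \<bullet> u) = w \<bullet> w"
    unfolding symmetric_matrix_inner[OF sym, of u w]
    by (simp_all add: w_def inner_diff_left inner_diff_right algebra_simps inner_commute)
  have "0 \<le> (u - s *\<^sub>R w) \<bullet> (A *v (u - s *\<^sub>R w)) - \<mu> * ((u - s *\<^sub>R w) \<bullet> (u - s *\<^sub>R w))"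
    using ge[of "u - s *\<^sub>R w"] by simp
  also have "\<dots> = (u \<bullet> (A *v u) - \<mu> * (u \<bullet> u)) - s * (u \<bullet> (A *v w) - \<mu> * (u \<bullet> w))
      - s * (w \<bullet> (A *v u) - \<mu> * (w \<bullet> u)) + s * s * c"
    by (simp add: c_def matrix_vector_mult_diff_distrib matrix_vector_mult_scaleR
        inner_diff_left inner_diff_right algebra_simps)
  also have "\<dots> = s * (s * c - 2 * (w \<bullet> w))"
    unfolding cross eq by (simp add: algebra_simps)
  finally have "2 * (w \<bullet> w) \<le> s * c"
    using s by (simp add: zero_le_mult_iff)
  moreover have "s * c \<le> w \<bullet> w"
    using c w by (simp add: s_def field_simps)
  ultimately show False using w by simp
qed

lemma positive_definite_invertible:
  fixes A :: "real^'n^'n"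
  assumes "positive_definite A"
  shows "invertible A"
proof -
  have "x = 0" if "A *v x = 0" for x
    using assms that unfolding positive_definite_def by (metis inner_zero_right less_irrefl)
  then show ?thesis
    using matrix_left_invertible_ker[of A] invertible_left_inverse[of A] by blast
qed

lemma matrix_inv_mult:
  fixes A :: "real^'n^'n"
  assumes "invertible A"
  shows "A ** matrix_inv A = mat 1" "matrix_inv A ** A = mat 1"
proof -
  have "\<exists>B. A ** B = mat 1 \<and> B ** A = mat 1"
    using assms by (simp add: invertible_def)
  then have "A ** matrix_inv A = mat 1 \<and> matrix_inv A ** A = mat 1"
    unfolding matrix_inv_def by (rule someI_ex)
  then show "A ** matrix_inv A = mat 1" "matrix_inv A ** A = mat 1" by auto
qed

lemma symmetric_matrix_inv:
  fixes A :: "real^'n^'n"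
  assumes "symmetric_matrix A" "invertible A"
  shows "symmetric_matrix (matrix_inv A)"
proof -
  have "transpose (matrix_inv A) ** A = mat 1"
    using matrix_inv_mult(1)[OF assms(2)] assms(1) unfolding symmetric_matrix_def
    by (metis matrix_transpose_mul transpose_mat)
  then show ?thesis
    unfolding symmetric_matrix_def using matrix_inv_mult(1)[OF assms(2)]
    by (metis matrix_mul_assoc matrix_mul_lid matrix_mul_rid)
qed

text \<open>The minimum \<open>\<mu>\<close> of the form over the unit sphere is an eigenvalue of \<open>Q\<close>, so \<open>1 / \<mu>\<close> is an
  eigenvalue of the inverse and thus at most the largest one.\<close>
lemma norm_le_lambda_max_form:
  fixes Q :: "real^'n^'n"
  assumes sym: "symmetric_matrix Q" and pd: "positive_definite Q"
  shows "lambda_max (matrix_inv Q) > 0"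
    and "x \<bullet> x \<le> lambda_max (matrix_inv Q) * (x \<bullet> (Q *v x))"
proof -
  let ?f = "\<lambda>x. x \<bullet> (Q *v x)"
  have inv: "invertible Q" by (rule positive_definite_invertible[OF pd])
  have "sphere (0::real^'n) 1 \<noteq> {}" by simp
  moreover have "continuous_on (sphere 0 1) ?f"
    by (intro continuous_intros linear_continuous_on matrix_vector_mul_bounded_linear)
  ultimately obtain u where u: "u \<in> sphere 0 1"
    and min: "\<And>y. y \<in> sphere 0 1 \<Longrightarrow> ?f u \<le> ?f y"
    using continuous_attains_inf[OF compact_sphere, of 0 1 ?f] by blast
  define \<mu> where "\<mu> = ?f u"
  have u0: "u \<noteq> 0" and uu: "u \<bullet> u = 1"
    using u by (auto simp: dot_square_norm)
  have \<mu>: "\<mu> > 0" using pd u0 by (simp add: \<mu>_def positive_definite_def)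
  have ge: "\<mu> * (y \<bullet> y) \<le> ?f y" for y
  proof (cases "y = 0")
    case False
    have "?f u \<le> ?f ((1 / norm y) *\<^sub>R y)" by (rule min) (use False in simp)
    also have "\<dots> = ?f y / (norm y)\<^sup>2"
      by (simp add: matrix_vector_mult_scaleR power2_eq_square)
    finally show ?thesis
      using False by (simp add: \<mu>_def dot_square_norm field_simps)
  qed simp
  have "Q *v u = \<mu> *\<^sub>R u"
    by (rule eigenvector_if_form_minimal[OF sym ge]) (simp add: \<mu>_def uu)
  then have "matrix_inv Q *v (\<mu> *\<^sub>R u) = u"
    using matrix_inv_mult(2)[OF inv]
    by (metis matrix_vector_mul_assoc matrix_vector_mul_lid)
  then have "\<mu> *\<^sub>R (matrix_inv Q *v u) = u"
    by (simp add: matrix_vector_mult_scaleR)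
  then have "(1 / \<mu>) *\<^sub>R (\<mu> *\<^sub>R (matrix_inv Q *v u)) = (1 / \<mu>) *\<^sub>R u"
    by (rule arg_cong)
  then have "matrix_inv Q *v u = (1 / \<mu>) *\<^sub>R u"
    using \<mu> by simp
  then have "is_eigenvalue (matrix_inv Q) (1 / \<mu>)"
    using u0 by (auto simp: is_eigenvalue_def)
  then have le: "1 / \<mu> \<le> lambda_max (matrix_inv Q)"
    unfolding lambda_max_def
    by (intro Max_ge finite_eigenvalues symmetric_matrix_inv sym inv) simp
  then show "lambda_max (matrix_inv Q) > 0"
    using \<mu> by (meson less_le_trans zero_less_divide_1_iff)
  have "x \<bullet> x \<le> 1 / \<mu> * ?f x"
    using ge[of x] \<mu> by (simp add: field_simps)
  also have "\<dots> \<le> lambda_max (matrix_inv Q) * ?f x"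
    using le by (rule mult_right_mono) (rule order_trans[OF _ ge], use \<mu> in simp)
  finally show "x \<bullet> x \<le> lambda_max (matrix_inv Q) * ?f x" .
qed

section \<open>The padded inverse of a principal submatrix\<close>

lemma is_inverse_on_inverse_on:
  fixes Q :: "real^'n^'n"
  assumes pd: "positive_definite Q"
  shows "is_inverse_on S (\<lambda>i j. Q$i$j) (inverse_on S (\<lambda>i j. Q$i$j))"
proof -
  \<comment> \<open>The block matrix with blocks \<open>Q\<^sub>S\<close> and the identity is again positive definite, and the
    \<open>S\<close>-block of its inverse inverts \<open>Q\<^sub>S\<close>.\<close>
  define A :: "real^'n^'n" where
    "A = (\<chi> i j. if i \<in> S \<and> j \<in> S then Q$i$j else of_bool (i = j))"
  have "positive_definite A"
    unfolding positive_definite_def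
  proof (intro allI impI)
    fix x :: "real^'n" assume x: "x \<noteq> 0"
    define y :: "real^'n" where "y = (\<chi> i. if i \<in> S then x$i else 0)"
    define t :: "real^'n" where "t = (\<chi> i. if i \<in> S then 0 else x$i)"
    have "x$i * (A *v x)$i = y$i * (Q *v y)$i + t$i * t$i" for i
    proof (cases "i \<in> S")
      case True
      have "(A *v x)$i = (Q *v y)$i"
        unfolding matrix_vector_mult_def vec_lambda_beta
        by (rule sum.cong) (use True in \<open>auto simp: A_def y_def\<close>)
      then show ?thesis using True by (simp add: y_def t_def)
    next
      case False
      have "(A *v x)$i = (\<Sum>j\<in>UNIV. if i = j then x$j else 0)"
        unfolding matrix_vector_mult_def vec_lambda_beta
        by (rule sum.cong) (use False in \<open>auto simp: A_def\<close>)
      then show ?thesis using False by (simp add: y_def t_def)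
    qed
    then have eq: "x \<bullet> (A *v x) = y \<bullet> (Q *v y) + t \<bullet> t"
      by (simp add: inner_vec_def sum.distrib)
    have "y \<noteq> 0 \<or> t \<noteq> 0"
      using x by (auto simp: vec_eq_iff y_def t_def)
    moreover have "y \<bullet> (Q *v y) > 0" if "y \<noteq> 0"
      using pd that by (simp add: positive_definite_def)
    ultimately show "x \<bullet> (A *v x) > 0"
      unfolding eq by (cases "y = 0") (auto intro: add_pos_nonneg)
  qed
  then have "invertible A" by (rule positive_definite_invertible)
  then obtain B where "A ** B = mat 1" "B ** A = mat 1"
    by (auto simp: invertible_def)
  then have AB: "(\<Sum>k\<in>UNIV. A$i$k * B$k$j) = of_bool (i = j)"
    and BA: "(\<Sum>k\<in>UNIV. B$i$k * A$k$j) = of_bool (i = j)" for i j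
    by (auto simp: matrix_matrix_mult_def mat_def vec_eq_iff)
  have "is_inverse_on S (\<lambda>i j. Q$i$j) (\<lambda>i j. B$i$j)"
    unfolding is_inverse_on_def
  proof (intro conjI ballI)
    fix i j assume ij: "i \<in> S" "j \<in> S"
    have "(\<Sum>k\<in>S. Q$i$k * B$k$j) = (\<Sum>k\<in>UNIV. A$i$k * B$k$j)"
      by (rule sum.mono_neutral_cong_left) (use ij in \<open>auto simp: A_def\<close>)
    then show "(\<Sum>k\<in>S. Q$i$k * B$k$j) = of_bool (i = j)" by (simp add: AB)
    have "(\<Sum>k\<in>S. B$i$k * Q$k$j) = (\<Sum>k\<in>UNIV. B$i$k * A$k$j)"
      by (rule sum.mono_neutral_cong_left) (use ij in \<open>auto simp: A_def\<close>)
    then show "(\<Sum>k\<in>S. B$i$k * Q$k$j) = of_bool (i = j)" by (simp add: BA)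
  qed
  then show ?thesis
    unfolding inverse_on_def by (intro someI_ex[of "is_inverse_on S _"] exI)
qed

lemma padded_inverse_outside:
  "i \<notin> S \<or> j \<notin> S \<Longrightarrow> padded_inverse Q S $ i $ j = 0"
  by (auto simp: padded_inverse_def)

lemma mult_padded_inverse:
  fixes Q :: "real^'n^'n"
  assumes pd: "positive_definite Q" and i: "i \<in> S"
  shows "(\<Sum>k\<in>UNIV. Q$i$k * padded_inverse Q S $ k $ j) = of_bool (i = j)"
proof (cases "j \<in> S")
  case True
  have "(\<Sum>k\<in>UNIV. Q$i$k * padded_inverse Q S $ k $ j) =
      (\<Sum>k\<in>S. Q$i$k * inverse_on S (\<lambda>i j. Q$i$j) k j)"
    by (rule sum.mono_neutral_cong_right) (use True in \<open>auto simp: padded_inverse_def\<close>)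
  then show ?thesis
    using is_inverse_on_inverse_on[OF pd, of S] i True
    by (simp add: is_inverse_on_def)
next
  case False
  then show ?thesis using i by (auto simp: padded_inverse_outside)
qed

lemma padded_inverse_unique:
  fixes Q W :: "real^'n^'n"
  assumes pd: "positive_definite Q"
    and out: "\<And>i j. i \<notin> S \<or> j \<notin> S \<Longrightarrow> W$i$j = 0"
    and right: "\<And>i j. i \<in> S \<Longrightarrow> j \<in> S \<Longrightarrow> (\<Sum>k\<in>UNIV. Q$i$k * W$k$j) = of_bool (i = j)"
  shows "W = padded_inverse Q S"
proof -
  define B where "B = inverse_on S (\<lambda>i j. Q$i$j)"
  have left: "(\<Sum>k\<in>S. B i k * Q$k$l) = of_bool (i = l)" if "i \<in> S" "l \<in> S" for i l
    using is_inverse_on_inverse_on[OF pd, of S] that by (simp add: is_inverse_on_def B_def)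
  have right': "(\<Sum>l\<in>S. Q$k$l * W$l$j) = of_bool (k = j)" if "k \<in> S" "j \<in> S" for k j
    unfolding right[OF that, symmetric]
    by (rule sum.mono_neutral_left) (auto simp: out)
  have "W$i$j = B i j" if ij: "i \<in> S" "j \<in> S" for i j
  proof -
    have "B i j = (\<Sum>k\<in>S. B i k * (\<Sum>l\<in>S. Q$k$l * W$l$j))"
      using ij by (simp add: right' of_bool_def if_distrib sum.delta cong: if_cong)
    also have "\<dots> = (\<Sum>k\<in>S. \<Sum>l\<in>S. B i k * Q$k$l * W$l$j)"
      by (simp add: sum_distrib_left mult.assoc)
    also have "\<dots> = (\<Sum>l\<in>S. \<Sum>k\<in>S. B i k * Q$k$l * W$l$j)"
      by (rule sum.swap)
    also have "\<dots> = (\<Sum>l\<in>S. (\<Sum>k\<in>S. B i k * Q$k$l) * W$l$j)"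
      by (simp add: sum_distrib_right)
    also have "\<dots> = W$i$j"
      using ij by (simp add: left of_bool_def if_distrib[of "\<lambda>x. x * _"] sum.delta cong: if_cong)
    finally show ?thesis by simp
  qed
  then show ?thesis
    using out by (auto simp: vec_eq_iff padded_inverse_def B_def)
qed

lemma norm_column_padded_inverse_le:
  fixes Q :: "real^'n^'n"
  assumes sym: "symmetric_matrix Q" and pd: "positive_definite Q"
  shows "norm (column j (padded_inverse Q S)) \<le> lambda_max (matrix_inv Q)"
proof -
  define w where "w = column j (padded_inverse Q S)"
  define L where "L = lambda_max (matrix_inv Q)"
  have L: "L > 0" unfolding L_def by (rule norm_le_lambda_max_form(1)[OF sym pd])
  have "w$i * (Q *v w)$i = (if i = j then w$j else 0)" for i
  proof (cases "i \<in> S")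
    case True
    then have "(Q *v w)$i = of_bool (i = j)"
      using mult_padded_inverse[OF pd True, of j]
      by (simp add: matrix_vector_mult_def w_def column_def)
    then show ?thesis by simp
  next
    case False
    then show ?thesis by (auto simp: w_def column_def padded_inverse_outside)
  qed
  then have "w \<bullet> (Q *v w) = w$j"
    by (simp add: inner_vec_def)
  then have "w \<bullet> w \<le> L * w$j"
    using norm_le_lambda_max_form(2)[OF sym pd, of w] by (simp add: L_def)
  also have "\<dots> \<le> L * norm w"
    using L component_le_norm_cart[of w j] by (intro mult_left_mono) auto
  finally have "norm w * norm w \<le> L * norm w"
    by (simp add: dot_square_norm power2_eq_square)
  then have "norm w \<le> L"
    using L by (cases "w = 0") auto
  then show ?thesis by (simp add: w_def L_def)
qed

section \<open>Extreme points and the linear description\<close>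

lemma extreme_points_polytope_P:
  fixes Q :: "real^'n^'n"
  shows "{p. p extreme_point_of (polytope_P Q Z)} = generators Q Z"
proof -
  have "finite (generators Q Z)"
    by (rule finite_subset[of _ "range (\<lambda>S. (indicator_vec S, padded_inverse Q S))"])
      (auto simp: generators_def)
  then have comp: "compact (generators Q Z)" by (rule finite_imp_compact)
  have indep: "g \<notin> convex hull (generators Q Z - {g})" if gen: "g \<in> generators Q Z" for g
  proof -
    obtain S where g: "g = (indicator_vec S, padded_inverse Q S)"
      using gen by (auto simp: generators_def)
    let ?a = "((\<chi> i. 2 * of_bool (i \<in> S) - 1), 0) :: (real^'n) \<times> (real^'n^'n)"
    \<comment> \<open>The difference of the two values is the number of indices at which the vertices differ.\<close>
    have "?a \<bullet> p < ?a \<bullet> g" if p: "p \<in> generators Q Z - {g}" for p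
    proof -
      obtain T where T: "p = (indicator_vec T, padded_inverse Q T)" "T \<noteq> S"
        using p g by (auto simp: generators_def)
      then obtain i where i: "i \<in> S \<longleftrightarrow> i \<notin> T" by auto
      have "0 < (\<Sum>i\<in>UNIV. (2 * of_bool (i \<in> S) - 1) * (of_bool (i \<in> S) - of_bool (i \<in> T)) :: real)"
        by (rule sum_pos2[of _ i]) (use i in auto)
      also have "\<dots> = ?a \<bullet> g - ?a \<bullet> p"
        by (simp add: g T indicator_vec_def inner_vec_def right_diff_distrib sum_subtractf)
      finally show ?thesis by simp
    qed
    then have "convex hull (generators Q Z - {g}) \<subseteq> {p. ?a \<bullet> p < ?a \<bullet> g}"
      by (intro hull_minimal convex_halfspace_lt) auto
    then show ?thesis by blast
  qed
  show ?thesis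
    using extreme_point_of_convex_hull_convex_independent[OF comp indep]
    by (auto simp: polytope_P_def)
qed

theorem proposition7:
  fixes Q :: "real^'n^'n" and Z :: "(real^'n) set" and M :: real
  assumes "symmetric_matrix Q" and "positive_definite Q"
    and "Z \<subseteq> {z. \<forall>i. z$i \<in> {0, 1}}"
    and "M = lambda_max (matrix_inv Q) * Max (range (\<lambda>i. norm (column i Q)))"
  shows "{p. p extreme_point_of (polytope_P Q Z)} = generators Q Z \<and>
    generators Q Z =
      {(z, W). z \<in> Z \<and>
         (\<forall>i. (\<Sum>k\<in>UNIV. Q$i$k * W$k$i) = z$i) \<and>
         (\<forall>i j. i \<noteq> j \<longrightarrow>
            - M * (1 - z$i) \<le> (\<Sum>k\<in>UNIV. Q$i$k * W$k$j) \<and>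
            (\<Sum>k\<in>UNIV. Q$i$k * W$k$j) \<le> M * (1 - z$i)) \<and>
         (\<forall>i j. \<bar>W$i$j\<bar> \<le> lambda_max (matrix_inv Q) * min (z$i) (z$j))}"
    (is "_ \<and> _ = ?R")
proof
  note sym = assms(1) and pd = assms(2)
  define L where "L = lambda_max (matrix_inv Q)"
  have L: "L > 0" unfolding L_def by (rule norm_le_lambda_max_form(1)[OF sym pd])
  show "{p. p extreme_point_of (polytope_P Q Z)} = generators Q Z"
    by (rule extreme_points_polytope_P)
  show "generators Q Z = ?R"
  proof (intro equalityI subsetI)
    fix p assume "p \<in> generators Q Z"
    then obtain S where p: "p = (indicator_vec S, padded_inverse Q S)" and S: "indicator_vec S \<in> Z"
      by (auto simp: generators_def)
    let ?z = "indicator_vec S :: real^'n" and ?W = "padded_inverse Q S"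
    have z: "?z$i = of_bool (i \<in> S)" for i by (simp add: indicator_vec_def)
    have diag: "(\<Sum>k\<in>UNIV. Q$i$k * ?W$k$i) = ?z$i" for i
      by (cases "i \<in> S") (simp_all add: mult_padded_inverse[OF pd] padded_inverse_outside z)
    have col: "norm (column j ?W) \<le> L" for j
      unfolding L_def by (rule norm_column_padded_inverse_le[OF sym pd])
    have off: "\<bar>\<Sum>k\<in>UNIV. Q$i$k * ?W$k$j\<bar> \<le> M * (1 - ?z$i)" if "i \<noteq> j" for i j
    proof (cases "i \<in> S")
      case True
      then show ?thesis using that by (simp add: mult_padded_inverse[OF pd] z)
    next
      case False
      have "Q$i$k = Q$k$i" for k
        using arg_cong[OF sym[unfolded symmetric_matrix_def], of "\<lambda>A. A$k$i"]
        by (simp add: transpose_def)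
      then have "(\<Sum>k\<in>UNIV. Q$i$k * ?W$k$j) = column i Q \<bullet> column j ?W"
        by (simp add: inner_vec_def column_def)
      then have "\<bar>\<Sum>k\<in>UNIV. Q$i$k * ?W$k$j\<bar> \<le> norm (column i Q) * norm (column j ?W)"
        by (simp add: Cauchy_Schwarz_ineq2)
      also have "\<dots> \<le> Max (range (\<lambda>i. norm (column i Q))) * L"
        by (intro mult_mono col norm_ge_zero) (auto intro: order_trans[OF norm_ge_zero[of "column i Q"]])
      finally show ?thesis using False by (simp add: z assms(4) L_def mult.commute)
    qed
    have ent: "\<bar>?W$i$j\<bar> \<le> L * min (?z$i) (?z$j)" for i j
    proof (cases "i \<in> S \<and> j \<in> S")
      case True
      have "\<bar>?W$i$j\<bar> \<le> norm (column j ?W)"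
        using component_le_norm_cart[of "column j ?W" i] by (simp add: column_def)
      then show ?thesis using col[of j] True by (simp add: z)
    next
      case False
      then show ?thesis using L by (auto simp: z padded_inverse_outside)
    qed
    show "p \<in> ?R"
      using S diag off ent by (auto simp: p abs_le_iff L_def minus_le_iff)
  next
    fix p assume "p \<in> ?R"
    then obtain z W where p: "p = (z, W)" and zZ: "z \<in> Z"
      and diag: "\<And>i. (\<Sum>k\<in>UNIV. Q$i$k * W$k$i) = z$i"
      and off: "\<And>i j. i \<noteq> j \<Longrightarrow> - M * (1 - z$i) \<le> (\<Sum>k\<in>UNIV. Q$i$k * W$k$j) \<and>
            (\<Sum>k\<in>UNIV. Q$i$k * W$k$j) \<le> M * (1 - z$i)"
      and ent: "\<And>i j. \<bar>W$i$j\<bar> \<le> L * min (z$i) (z$j)"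
      by (auto simp: L_def)
    define S where "S = {i. z$i = 1}"
    have z01: "z$i = 0 \<or> z$i = 1" for i using assms(3) zZ by auto
    have z: "z = indicator_vec S"
      using z01 by (auto simp: vec_eq_iff indicator_vec_def S_def)
    have "W = padded_inverse Q S"
    proof (rule padded_inverse_unique[OF pd])
      fix i j assume "i \<notin> S \<or> j \<notin> S"
      then have "min (z$i) (z$j) = 0" using z01[of i] z01[of j] by (auto simp: S_def)
      then show "W$i$j = 0" using ent[of i j] by simp
    next
      fix i j assume "i \<in> S" "j \<in> S"
      then show "(\<Sum>k\<in>UNIV. Q$i$k * W$k$j) = of_bool (i = j)"
        using diag[of i] off[of i j] by (cases "i = j") (auto simp: S_def)
    qed
    then show "p \<in> generators Q Z"
      using z zZ by (auto simp: p generators_def)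
  qed
qed

end
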